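(* Let $r\geq 1$ be an integer and let $k>0$ and $m$ be integers. If $m>r+k$, then the element $d_mt^k$ of the lamplighter group $\mathcal{L}_2$ satisfies $\kappa_r^{\mathcal S}(d_mt^k)>0$.
   Context: The lamplighter group is $\mathcal{L}_2=\mathbb{Z}_2\wr\mathbb{Z}=(\bigoplus_{i\in\mathbb{Z}}\mathbb{Z}_2)\rtimes\mathbb{Z}$, with $\mathbb{Z}$ permuting the factors by translation, and standard generating set $\{a,t\}$, where $a$ generates the copy of $\mathbb{Z}_2$ at index $0$ and $t$ generates $\mathbb{Z}$. Put $a_i=t^{-i}at^i$ for $i\in\mathbb{Z}$ (these commute pairwise) and $d_m=a_0a_1\cdots a_ma_{-1}\cdots a_{-m}$. Let $|x|$ denote word length with respect to $\{a,t,t^{-1}\}$ and $S_r=\{w\in\mathcal{L}_2: |w|=r\}$. For $g\ne e$, the spherical comparison curvature of radius $r$ is $$\kappa_r^{\mathcal S}(g)=\frac{|g|-\frac{1}{|S_r|}\sum_{w\in S_r}|w^{-1}gw|}{|g|}.$$ *)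

theory Defs
  imports Complex_Main "HOL-Algebra.Product_Groups" "HOL-Algebra.Elementary_Groups"
begin

definition semidirect_product ::
    "('a, 'c) monoid_scheme \<Rightarrow> ('b, 'd) monoid_scheme \<Rightarrow> ('b \<Rightarrow> 'a \<Rightarrow> 'a) \<Rightarrow> ('a \<times> 'b) monoid"
  where "semidirect_product N H \<phi> =
    \<lparr>carrier = carrier N \<times> carrier H,
     monoid.mult = (\<lambda>(x, h) (y, k). (x \<otimes>\<^bsub>N\<^esub> \<phi> h y, h \<otimes>\<^bsub>H\<^esub> k)),
     one = (\<one>\<^bsub>N\<^esub>, \<one>\<^bsub>H\<^esub>)\<rparr>"

(* The direction of the translation is chosen such that t^(-i) a t^i generates the copy of Z_2
   at index i (lemma lamp_eq below); the opposite choice gives an isomorphic group, by an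
   isomorphism that fixes a and t. *)
definition lamplighter :: "((int \<Rightarrow> int) \<times> int) monoid"
  where "lamplighter =
    semidirect_product (sum_group UNIV (\<lambda>_::int. integer_mod_group 2)) integer_group
      (\<lambda>n f i. f (i + n))"

definition gen_a :: "(int \<Rightarrow> int) \<times> int"
  where "gen_a = ((\<lambda>i. if i = 0 then 1 else 0), 0)"

definition gen_t :: "(int \<Rightarrow> int) \<times> int"
  where "gen_t = ((\<lambda>_. 0), 1)"

definition lamp :: "int \<Rightarrow> (int \<Rightarrow> int) \<times> int"
  where "lamp i =
    gen_t [^]\<^bsub>lamplighter\<^esub> (- i) \<otimes>\<^bsub>lamplighter\<^esub> gen_a \<otimes>\<^bsub>lamplighter\<^esub> gen_t [^]\<^bsub>lamplighter\<^esub> i"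

definition list_prod :: "('a, 'b) monoid_scheme \<Rightarrow> 'a list \<Rightarrow> 'a"
  where "list_prod G xs = foldr (\<otimes>\<^bsub>G\<^esub>) xs \<one>\<^bsub>G\<^esub>"

definition d_elem :: "int \<Rightarrow> (int \<Rightarrow> int) \<times> int"
  where "d_elem m = list_prod lamplighter (map lamp [0..m] @ map (\<lambda>i. lamp (- i)) [1..m])"

(* The letters are the elements of S themselves; inverses have to be put into S.
   The value is only meaningful for x in the submonoid generated by S. *)
definition word_length :: "('a, 'b) monoid_scheme \<Rightarrow> 'a set \<Rightarrow> 'a \<Rightarrow> nat"
  where "word_length G S x =
    (LEAST n. \<exists>ws. length ws = n \<and> set ws \<subseteq> S \<and> list_prod G ws = x)"

definition word_sphere :: "('a, 'b) monoid_scheme \<Rightarrow> 'a set \<Rightarrow> nat \<Rightarrow> 'a set"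
  where "word_sphere G S r = {w \<in> carrier G. word_length G S w = r}"

definition spherical_curvature ::
    "('a, 'b) monoid_scheme \<Rightarrow> 'a set \<Rightarrow> nat \<Rightarrow> 'a \<Rightarrow> real"
  where "spherical_curvature G S r g =
    (real (word_length G S g)
      - 1 / real (card (word_sphere G S r))
        * (\<Sum>w\<in>word_sphere G S r. real (word_length G S (inv\<^bsub>G\<^esub> w \<otimes>\<^bsub>G\<^esub> g \<otimes>\<^bsub>G\<^esub> w))))
    / real (word_length G S g)"

definition lamplighter_gens :: "((int \<Rightarrow> int) \<times> int) set"
  where "lamplighter_gens = {gen_a, gen_t, inv\<^bsub>lamplighter\<^esub> gen_t}"


lemma carrier_lamplighter:
  "carrier lamplighter = {f. range f \<subseteq> {0, 1} \<and> finite {i. f i \<noteq> 0}} \<times> UNIV"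
proof -
  have "{0..<2::int} = {0, 1}"
    by auto
  then show ?thesis
    by (auto simp: lamplighter_def semidirect_product_def carrier_sum_group integer_group_def
        carrier_integer_mod_group PiE_UNIV_domain)
qed

lemma mult_lamplighter:
  "(f, m) \<otimes>\<^bsub>lamplighter\<^esub> (g, n) = ((\<lambda>i. (f i + g (i + m)) mod 2), m + n)"
  by (simp add: lamplighter_def semidirect_product_def integer_group_def restrict_UNIV)

lemma one_lamplighter: "\<one>\<^bsub>lamplighter\<^esub> = ((\<lambda>_. 0), 0)"
  by (simp add: lamplighter_def semidirect_product_def integer_group_def restrict_def)

lemma finite_shift: "finite {i::int. f i \<noteq> (0::int)} \<Longrightarrow> finite {i. f (i + m) \<noteq> 0}"
  using finite_vimageI[of "{i. f i \<noteq> 0}" "\<lambda>i. i + m"] by (simp add: vimage_def)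

lemma group_lamplighter: "group lamplighter"
proof (rule groupI)
  fix x y assume "x \<in> carrier lamplighter" "y \<in> carrier lamplighter"
  then obtain f m g n where xy: "x = (f, m)" "y = (g, n)"
    and fin: "finite {i. f i \<noteq> 0}" "finite {i. g i \<noteq> 0}"
    by (auto simp: carrier_lamplighter)
  have "{i. (f i + g (i + m)) mod 2 \<noteq> 0} \<subseteq> {i. f i \<noteq> 0} \<union> {i. g (i + m) \<noteq> 0}"
    by auto
  then have "finite {i. (f i + g (i + m)) mod 2 \<noteq> 0}"
    using fin finite_shift[OF fin(2)] finite_subset by blast
  then show "x \<otimes>\<^bsub>lamplighter\<^esub> y \<in> carrier lamplighter"
    by (auto simp: xy mult_lamplighter carrier_lamplighter)
next
  show "\<one>\<^bsub>lamplighter\<^esub> \<in> carrier lamplighter"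
    by (auto simp: one_lamplighter carrier_lamplighter)
next
  fix x y z :: "(int \<Rightarrow> int) \<times> int"
  show "x \<otimes>\<^bsub>lamplighter\<^esub> y \<otimes>\<^bsub>lamplighter\<^esub> z = x \<otimes>\<^bsub>lamplighter\<^esub> (y \<otimes>\<^bsub>lamplighter\<^esub> z)"
    by (cases x; cases y; cases z)
      (simp add: mult_lamplighter mod_add_left_eq mod_add_right_eq add_ac)
next
  fix x assume x: "x \<in> carrier lamplighter"
  then obtain f m where xf: "x = (f, m)" and f01: "\<And>i. f i = 0 \<or> f i = 1"
    and fin: "finite {i. f i \<noteq> 0}"
    by (fastforce simp: carrier_lamplighter)
  have md: "f i mod 2 = f i" for i
    using f01[of i] by auto
  show "\<one>\<^bsub>lamplighter\<^esub> \<otimes>\<^bsub>lamplighter\<^esub> x = x"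
    by (simp add: xf one_lamplighter mult_lamplighter md)
  show "\<exists>y\<in>carrier lamplighter. y \<otimes>\<^bsub>lamplighter\<^esub> x = \<one>\<^bsub>lamplighter\<^esub>"
  proof
    show "((\<lambda>i. f (i + - m)), - m) \<in> carrier lamplighter"
      using f01 finite_shift[OF fin, of "- m"] by (auto simp: carrier_lamplighter)
    show "((\<lambda>i. f (i + - m)), - m) \<otimes>\<^bsub>lamplighter\<^esub> x = \<one>\<^bsub>lamplighter\<^esub>"
      using f01 by (simp add: xf mult_lamplighter one_lamplighter)
  qed
qed

lemma gens_closed: "gen_a \<in> carrier lamplighter" "gen_t \<in> carrier lamplighter"
  by (auto simp: carrier_lamplighter gen_a_def gen_t_def)

lemma gen_t_int_pow: "gen_t [^]\<^bsub>lamplighter\<^esub> (n::int) = ((\<lambda>_. 0), n)"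
proof -
  interpret group lamplighter by (rule group_lamplighter)
  have nat: "gen_t [^]\<^bsub>lamplighter\<^esub> (k::nat) = ((\<lambda>_. 0), int k)" for k
    by (induction k) (auto simp: one_lamplighter mult_lamplighter gen_t_def)
  have inv: "inv\<^bsub>lamplighter\<^esub> ((\<lambda>_. 0), int k) = ((\<lambda>_. 0), - int k)" for k
    by (rule inv_equality) (auto simp: mult_lamplighter one_lamplighter carrier_lamplighter)
  then show ?thesis
    using inv[of "nat (- n)"] by (auto simp: int_pow_def2 nat split: if_splits)
qed

lemma lamp_eq: "lamp i = ((\<lambda>j. if j = i then 1 else 0), 0)"
  by (auto simp: lamp_def gen_t_int_pow gen_a_def mult_lamplighter fun_eq_iff)

end

(*
  Read an element (f, n) as the lamp configuration f together with the cursor position -n.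
  A word for (f, n) is a walk of the cursor from 0 to -n; if the walk covers exactly the interval
  [L, M], it has at least 2 (M - L) - |n| moves, and sweeping right, left and right again
  achieves this bound when n >= 0.
  Conjugating d_m t^k by w = (h, p) with |w| = r turns the configuration, up to translation,
  into the indicator of [-m, m] plus h plus a translate of h by k. As m > r + k, the interval to
  be covered is merely translated and the number of moves does not grow, while the set of lit
  lamps stays inside an interval of 2 m + 1 points and, if h is nonzero, misses the point
  of this interval that corresponds to the maximum of the support of h.
*)
theory Submission
  imports Defs
begin

section \<open>Words and word length in general\<close>

lemma (in monoid) list_prod_closed:
  "set ws \<subseteq> carrier G \<Longrightarrow> list_prod G ws \<in> carrier G"
  by (induction ws) (auto simp: list_prod_def)

lemma (in monoid) list_prod_snoc:
  assumes "set ws \<subseteq> carrier G" and "s \<in> carrier G"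
  shows "list_prod G (ws @ [s]) = list_prod G ws \<otimes> s"
  using assms
proof (induction ws)
  case Nil
  then show ?case by (simp add: list_prod_def)
next
  case (Cons x ws)
  then have "list_prod G ws \<in> carrier G" by (simp add: list_prod_closed)
  with Cons show ?case by (simp add: list_prod_def m_assoc)
qed

lemma word_length_le:
  "set ws \<subseteq> S \<Longrightarrow> list_prod G ws = x \<Longrightarrow> word_length G S x \<le> length ws"
  unfolding word_length_def by (rule Least_le) blast

text \<open>The word \<open>vs\<close> makes the LEAST range over a nonempty set of lengths, so it
  is a genuine minimum.\<close>

lemma word_length_attained:
  assumes "set vs \<subseteq> S" and "list_prod G vs = x"
  obtains ws where "set ws \<subseteq> S" and "list_prod G ws = x" and "length ws = word_length G S x"
proof -
  have "\<exists>ws. length ws = word_length G S x \<and> set ws \<subseteq> S \<and> list_prod G ws = x"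
    unfolding word_length_def by (rule LeastI[of _ "length vs"]) (use assms in blast)
  then show ?thesis using that by blast
qed

lemma inv_lamplighter:
  assumes "(f, n) \<in> carrier lamplighter"
  shows "inv\<^bsub>lamplighter\<^esub> (f, n) = ((\<lambda>i. f (i - n)), - n)"
proof -
  interpret group lamplighter by (rule group_lamplighter)
  have f01: "f i = 0 \<or> f i = 1" for i
    using assms by (auto simp: carrier_lamplighter)
  have "finite {i. f i \<noteq> 0}"
    using assms by (auto simp: carrier_lamplighter)
  then have fin: "finite {i. f (i - n) \<noteq> 0}"
    using finite_shift[of f "- n"] by simp
  have dbl: "(f i + f i) mod 2 = 0" for i
    using f01[of i] by auto
  show ?thesis
    by (rule inv_equality)
      (use assms f01 fin dbl in \<open>auto simp: mult_lamplighter one_lamplighter carrier_lamplighter\<close>)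
qed

lemma inv_gen_t: "inv\<^bsub>lamplighter\<^esub> gen_t = ((\<lambda>_. 0), - 1)"
  using gens_closed(2) by (simp add: gen_t_def inv_lamplighter)

lemma lamplighter_gens_closed: "lamplighter_gens \<subseteq> carrier lamplighter"
  using gens_closed by (auto simp: lamplighter_gens_def inv_gen_t carrier_lamplighter)

section \<open>Upper bounds for word length\<close>

text \<open>Asks for an actual word, so that it also shows that the generators generate the group.
  The bound is an integer to avoid truncated subtraction.\<close>

definition word_within :: "(int \<Rightarrow> int) \<times> int \<Rightarrow> int \<Rightarrow> bool"
  where "word_within x N \<longleftrightarrow>
    (\<exists>ws. set ws \<subseteq> lamplighter_gens \<and> list_prod lamplighter ws = x \<and> int (length ws) \<le> N)"

lemma word_within_mult:
  assumes "word_within x N" and s: "s \<in> lamplighter_gens"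
  shows "word_within (x \<otimes>\<^bsub>lamplighter\<^esub> s) (N + 1)"
proof -
  interpret group lamplighter by (rule group_lamplighter)
  obtain ws where ws: "set ws \<subseteq> lamplighter_gens" "list_prod lamplighter ws = x"
    "int (length ws) \<le> N"
    using assms unfolding word_within_def by blast
  have "list_prod lamplighter (ws @ [s]) = x \<otimes>\<^bsub>lamplighter\<^esub> s"
    using list_prod_snoc[of ws s] ws s lamplighter_gens_closed by auto
  with ws s show ?thesis
    unfolding word_within_def by (intro exI[of _ "ws @ [s]"]) auto
qed

lemma word_within_shift:
  assumes "word_within (f, n) N" and f01: "\<And>i. f i = 0 \<or> f i = 1"
  shows "word_within (f, n') (N + \<bar>n' - n\<bar>)"
proof -
  have md: "f i mod 2 = f i" for i using f01[of i] by auto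
  have up: "word_within (f, n + int j) (N + int j)" for j
  proof (induction j)
    case (Suc j)
    from word_within_mult[OF this, of gen_t] show ?case
      by (simp add: lamplighter_gens_def gen_t_def mult_lamplighter md algebra_simps)
  qed (use assms in simp)
  have down: "word_within (f, n - int j) (N + int j)" for j
  proof (induction j)
    case (Suc j)
    from word_within_mult[OF this, of "inv\<^bsub>lamplighter\<^esub> gen_t"] show ?case
      by (simp add: lamplighter_gens_def inv_gen_t mult_lamplighter md algebra_simps)
  qed (use assms in simp)
  show ?thesis
    using up[of "nat (n' - n)"] down[of "nat (n - n')"] by (cases "n \<le> n'") auto
qed

text \<open>Right multiplication by \<open>gen_a\<close> toggles the lamp under the cursor, at
  \<open>- n\<close>. The letter is spent only if \<open>f\<close> is lit there, and the growth of
  the cardinality pays for it.\<close>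

lemma word_within_toggle:
  assumes "word_within ((\<lambda>i. if i > - n then f i else 0), n) (N + int (card {i. f i \<noteq> 0 \<and> i > - n}))"
    and f01: "\<And>i. f i = 0 \<or> f i = 1" and fin: "finite {i. f i \<noteq> 0}"
  shows "word_within ((\<lambda>i. if i \<ge> - n then f i else 0), n) (N + int (card {i. f i \<noteq> 0 \<and> i \<ge> - n}))"
proof (cases "f (- n) = 0")
  case True
  then have "(\<lambda>i. if i \<ge> - n then f i else 0) = (\<lambda>i. if i > - n then f i else 0)"
    "{i. f i \<noteq> 0 \<and> i \<ge> - n} = {i. f i \<noteq> 0 \<and> i > - n}"
    by (auto simp: fun_eq_iff order_le_less)
  with assms(1) show ?thesis by simp
next
  case False
  then have f1: "f (- n) = 1" using f01[of "- n"] by simp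
  have "{i. f i \<noteq> 0 \<and> i \<ge> - n} = insert (- n) {i. f i \<noteq> 0 \<and> i > - n}"
    using False by auto
  moreover have "finite {i. f i \<noteq> 0 \<and> i > - n}"
    using fin by (rule rev_finite_subset) auto
  ultimately have card: "card {i. f i \<noteq> 0 \<and> i \<ge> - n} = Suc (card {i. f i \<noteq> 0 \<and> i > - n})"
    by simp
  have md: "f i mod 2 = f i" for i using f01[of i] by auto
  have "((\<lambda>i. if i > - n then f i else 0), n) \<otimes>\<^bsub>lamplighter\<^esub> gen_a
      = ((\<lambda>i. if i \<ge> - n then f i else 0), n)"
    using f1 md by (auto simp: gen_a_def mult_lamplighter fun_eq_iff add_eq_0_iff2)
  with word_within_mult[OF assms(1), of gen_a] show ?thesis
    by (simp add: lamplighter_gens_def card algebra_simps)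
qed

text \<open>The cursor goes from 0 to \<open>M\<close>, then left to \<open>L\<close> while setting
  the lamps, then right to \<open>- n\<close>. These are \<open>M + (M - L) + (- n - L)\<close>
  moves, plus one letter for each lit lamp.\<close>

lemma word_within_interval:
  assumes f01: "\<And>i. f i = 0 \<or> f i = 1" and supp: "{i. f i \<noteq> 0} \<subseteq> {L..M}"
    and "L \<le> 0" "0 \<le> M" "L \<le> - n"
  shows "word_within (f, n) (int (card {i. f i \<noteq> 0}) + 2 * (M - L) - n)"
proof -
  have fin: "finite {i. f i \<noteq> 0}"
    using supp by (rule finite_subset) simp
  have "word_within ((\<lambda>_. 0), 0) 0"
    unfolding word_within_def
    by (intro exI[of _ "[]"]) (simp add: list_prod_def one_lamplighter)
  then have start: "word_within ((\<lambda>_. 0), - M) M"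
    using word_within_shift[of "\<lambda>_. 0" 0 0 "- M"] \<open>0 \<le> M\<close> by simp
  \<comment> \<open>State after \<open>j\<close> moves to the left from \<open>M\<close>: the lamp
    under the cursor is still unset, hence the strict inequality.\<close>
  have sweep: "word_within ((\<lambda>i. if i > M - int j then f i else 0), int j - M)
      (M + int j + int (card {i. f i \<noteq> 0 \<and> i > M - int j}))" for j
  proof (induction j)
    case 0
    have none: "{i. f i \<noteq> 0 \<and> i > M} = {}" using supp by auto
    then have "(\<lambda>i. if i > M then f i else 0) = (\<lambda>_. 0)"
      by (auto simp: fun_eq_iff)
    then show ?case by (simp add: start none)
  next
    case (Suc j)
    let ?n = "int j - M"
    have "word_within ((\<lambda>i. if i \<ge> - ?n then f i else 0), ?n)
        (M + int j + int (card {i. f i \<noteq> 0 \<and> i \<ge> - ?n}))"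
      by (rule word_within_toggle) (use Suc f01 fin in auto)
    from word_within_shift[OF this, of "?n + 1"] f01
    have *: "word_within ((\<lambda>i. if i \<ge> - ?n then f i else 0), ?n + 1)
        (M + int j + int (card {i. f i \<noteq> 0 \<and> i \<ge> - ?n}) + 1)"
      by auto
    have "(i \<ge> - ?n) = (i > M - int (Suc j))" for i by auto
    with * show ?case by (simp add: algebra_simps)
  qed
  \<comment> \<open>The sweep stops with the cursor at \<open>L\<close>, where one last lamp remains
    to be set.\<close>
  have "word_within ((\<lambda>i. if i \<ge> - (- L) then f i else 0), - L)
      (2 * M - L + int (card {i. f i \<noteq> 0 \<and> i \<ge> - (- L)}))"
    by (rule word_within_toggle)
      (use sweep[of "nat (M - L)"] f01 fin \<open>L \<le> 0\<close> \<open>0 \<le> M\<close> in auto)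
  moreover have "(\<lambda>i. if i \<ge> L then f i else 0) = f"
    "{i. f i \<noteq> 0 \<and> i \<ge> L} = {i. f i \<noteq> 0}"
    using supp by (auto simp: fun_eq_iff)
  ultimately have "word_within (f, - L) (2 * M - L + int (card {i. f i \<noteq> 0}))"
    by simp
  from word_within_shift[OF this f01, of n] show ?thesis
    using \<open>L \<le> - n\<close> by (simp add: algebra_simps)
qed

lemma word_length_le_interval:
  assumes "\<And>i. f i = 0 \<or> f i = 1" and "{i. f i \<noteq> 0} \<subseteq> {L..M}"
    and "L \<le> 0" "0 \<le> M" "L \<le> - n"
  shows "int (word_length lamplighter lamplighter_gens (f, n))
    \<le> int (card {i. f i \<noteq> 0}) + 2 * (M - L) - n"
proof -
  obtain ws where "set ws \<subseteq> lamplighter_gens" "list_prod lamplighter ws = (f, n)"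
    and "int (length ws) \<le> int (card {i. f i \<noteq> 0}) + 2 * (M - L) - n"
    using word_within_interval[OF assms] unfolding word_within_def by blast
  then show ?thesis
    using word_length_le[of ws lamplighter_gens lamplighter "(f, n)"] by linarith
qed

section \<open>Lower bounds for word length\<close>

text \<open>\<open>{L..M}\<close> is constructed as the range of the cursor. The induction removes
  the last letter because right multiplication acts at the current cursor: a toggle changes at most
  one lamp inside the range, and a move changes no lamp.\<close>

lemma word_support_interval:
  assumes "set ws \<subseteq> lamplighter_gens" and "list_prod lamplighter ws = (f, n)"
  shows "\<exists>L M. L \<le> 0 \<and> 0 \<le> M \<and> L \<le> - n \<and> - n \<le> M \<and> {i. f i \<noteq> 0} \<subseteq> {L..M} \<and>
    int (card {i. f i \<noteq> 0}) + 2 * (M - L) - \<bar>n\<bar> \<le> int (length ws)"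
  using assms
proof (induction ws arbitrary: f n rule: rev_induct)
  case Nil
  then show ?case
    by (intro exI[of _ 0]) (auto simp: list_prod_def one_lamplighter)
next
  case (snoc s ws)
  interpret group lamplighter by (rule group_lamplighter)
  obtain g p where gp: "list_prod lamplighter ws = (g, p)" by fastforce
  have "set ws \<subseteq> lamplighter_gens" using snoc.prems by simp
  from snoc.IH[OF this gp] obtain L M where LM: "L \<le> 0" "0 \<le> M" "L \<le> - p" "- p \<le> M"
    and supp: "{i. g i \<noteq> 0} \<subseteq> {L..M}"
    and len: "int (card {i. g i \<noteq> 0}) + 2 * (M - L) - \<bar>p\<bar> \<le> int (length ws)"
    by blast
  have fin: "finite {i. g i \<noteq> 0}"
    using supp by (rule finite_subset) simp
  have "set ws \<subseteq> carrier lamplighter" "s \<in> carrier lamplighter"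
    using snoc.prems(1) lamplighter_gens_closed by auto
  from list_prod_snoc[OF this] have eq: "(f, n) = (g, p) \<otimes>\<^bsub>lamplighter\<^esub> s"
    by (simp only: snoc.prems(2) gp)
  have "s = gen_a \<or> (\<exists>e. s = ((\<lambda>_. 0), e) \<and> (e = 1 \<or> e = - 1))"
    using snoc.prems unfolding lamplighter_gens_def inv_gen_t by (auto simp: gen_t_def)
  then show ?case
  proof
    assume "s = gen_a"
    with eq have n: "n = p" and f: "f = (\<lambda>i. (g i + (if i + p = 0 then 1 else 0)) mod 2)"
      by (auto simp: gen_a_def mult_lamplighter)
    have sub: "{i. f i \<noteq> 0} \<subseteq> insert (- p) {i. g i \<noteq> 0}"
      by (auto simp: f split: if_splits)
    have "card {i. f i \<noteq> 0} \<le> Suc (card {i. g i \<noteq> 0})"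
      using card_mono[OF _ sub] fin by (simp add: card_insert_if split: if_splits)
    moreover have "{i. f i \<noteq> 0} \<subseteq> {L..M}"
      using sub supp LM by (auto simp del: mem_Collect_eq)
    ultimately show ?thesis
      using LM len n by (intro exI[of _ L] exI[of _ M]) auto
  next
    assume "\<exists>e. s = ((\<lambda>_. 0), e) \<and> (e = 1 \<or> e = - 1)"
    then obtain e where e: "s = ((\<lambda>_. 0), e)" "e = 1 \<or> e = - 1" by blast
    with eq have n: "n = p + e" and f: "f = (\<lambda>i. g i mod 2)"
      by (auto simp: mult_lamplighter)
    have sub: "{i. f i \<noteq> 0} \<subseteq> {i. g i \<noteq> 0}"
      by (auto simp: f)
    have "card {i. f i \<noteq> 0} \<le> card {i. g i \<noteq> 0}"
      using fin sub by (rule card_mono)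
    moreover have "{i. f i \<noteq> 0} \<subseteq> {min L (- n)..max M (- n)}"
      using sub supp by (fastforce simp del: mem_Collect_eq)
    \<comment> \<open>A move within the range changes only the absolute value, by 1. A move out of
      it leads away from 0, so the range term grows by 2 and the absolute value by 1. Either way at
      most one letter is charged.\<close>
    moreover have "2 * (max M (- n) - min L (- n)) - \<bar>n\<bar> \<le> 2 * (M - L) - \<bar>p\<bar> + 1"
      using LM n e(2) by (smt (verit))
    ultimately show ?thesis
      using LM len by (intro exI[of _ "min L (- n)"] exI[of _ "max M (- n)"]) auto
  qed
qed

text \<open>The hull of the support, 0 and \<open>- n\<close> is an interval to which
  \<open>word_within_interval\<close> applies; hence \<open>word_length\<close> is meaningful on the
  whole carrier.\<close>

lemma carrier_word:
  assumes "x \<in> carrier lamplighter"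
  obtains ws where "set ws \<subseteq> lamplighter_gens" and "list_prod lamplighter ws = x"
    and "length ws = word_length lamplighter lamplighter_gens x"
proof -
  obtain f n where x: "x = (f, n)" by fastforce
  with assms have f01: "\<And>i. f i = 0 \<or> f i = 1" and fin: "finite {i. f i \<noteq> 0}"
    by (auto simp: carrier_lamplighter)
  let ?A = "insert 0 (insert (- n) {i. f i \<noteq> 0})"
  have "finite ?A" using fin by simp
  then have "?A \<subseteq> {Min ?A..Max ?A}"
    by (meson Min_le Max_ge atLeastAtMost_iff subsetI)
  then have "{i. f i \<noteq> 0} \<subseteq> {Min ?A..Max ?A}" "Min ?A \<le> 0" "0 \<le> Max ?A" "Min ?A \<le> - n"
    unfolding insert_subset atLeastAtMost_iff by blast+
  from word_within_interval[OF f01 this] obtain vs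
    where "set vs \<subseteq> lamplighter_gens" "list_prod lamplighter vs = x"
    unfolding word_within_def x by blast
  then show ?thesis
    using that by (rule word_length_attained)
qed

lemma word_length_support_interval:
  assumes "(f, n) \<in> carrier lamplighter"
  obtains L M where "L \<le> 0" "0 \<le> M" "L \<le> - n" "- n \<le> M" "{i. f i \<noteq> 0} \<subseteq> {L..M}"
    "int (card {i. f i \<noteq> 0}) + 2 * (M - L) - \<bar>n\<bar>
      \<le> int (word_length lamplighter lamplighter_gens (f, n))"
  using carrier_word[OF assms] word_support_interval by metis

text \<open>Elements of the sphere are products of words of length \<open>r\<close> over a finite
  alphabet. Finiteness keeps \<open>card\<close> and the sum over the sphere from taking the default
  value 0.\<close>

lemma finite_lamplighter_sphere: "finite (word_sphere lamplighter lamplighter_gens r)"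
proof (rule finite_subset)
  let ?W = "{ws. set ws \<subseteq> lamplighter_gens \<and> length ws = r}"
  show "word_sphere lamplighter lamplighter_gens r \<subseteq> list_prod lamplighter ` ?W"
  proof
    fix x assume "x \<in> word_sphere lamplighter lamplighter_gens r"
    then have "x \<in> carrier lamplighter" "word_length lamplighter lamplighter_gens x = r"
      by (auto simp: word_sphere_def)
    then show "x \<in> list_prod lamplighter ` ?W"
      by (elim carrier_word) (auto intro!: image_eqI[OF sym])
  qed
  show "finite (list_prod lamplighter ` ?W)"
    by (intro finite_imageI finite_lists_length_eq) (simp add: lamplighter_gens_def)
qed

section \<open>The element d_m t^k and its conjugates\<close>

lemma list_prod_lamp:
  assumes "distinct js"
  shows "list_prod lamplighter (map lamp js) = ((\<lambda>i. if i \<in> set js then 1 else 0), 0)"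
  using assms
  by (induction js) (auto simp: list_prod_def one_lamplighter lamp_eq mult_lamplighter fun_eq_iff)

lemma d_elem_eq:
  "d_elem m = ((\<lambda>i. if \<bar>i\<bar> \<le> m then 1 else 0), 0)"
proof -
  have mem: "i \<in> set ([0..m] @ map uminus [1..m]) \<longleftrightarrow> \<bar>i\<bar> \<le> m" for i
    by (auto simp: image_iff intro: bexI[of _ "- i"])
  have "d_elem m = list_prod lamplighter (map lamp ([0..m] @ map uminus [1..m]))"
    by (simp add: d_elem_def comp_def)
  also have "\<dots> = ((\<lambda>i. if i \<in> set ([0..m] @ map uminus [1..m]) then 1 else 0), 0)"
    by (rule list_prod_lamp) (auto simp: distinct_map inj_on_def)
  finally show ?thesis by (simp only: mem)
qed

lemma d_elem_gen_t_pow: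
  "d_elem m \<otimes>\<^bsub>lamplighter\<^esub> gen_t [^]\<^bsub>lamplighter\<^esub> (k::int)
    = ((\<lambda>i. if \<bar>i\<bar> \<le> m then 1 else 0), k)"
  by (auto simp: d_elem_eq gen_t_int_pow mult_lamplighter)

text \<open>All \<open>2 * m + 1\<close> lamps of [-m, m] are lit, and covering them forces
  \<open>M - L \<ge> 2 * m\<close>.\<close>

lemma d_elem_gen_t_pow_length:
  assumes "0 < k" and "0 \<le> m"
  shows "6 * m + 1 - k \<le> int (word_length lamplighter lamplighter_gens
    (d_elem m \<otimes>\<^bsub>lamplighter\<^esub> gen_t [^]\<^bsub>lamplighter\<^esub> k))"
proof -
  let ?f = "\<lambda>i::int. if \<bar>i\<bar> \<le> m then 1 else 0 :: int"
  have supp: "{i. ?f i \<noteq> 0} = {- m..m}" by auto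
  then have "finite {i. ?f i \<noteq> 0}" by simp
  then have "(?f, k) \<in> carrier lamplighter"
    by (simp add: carrier_lamplighter image_subset_iff)
  then obtain L M where "{i. ?f i \<noteq> 0} \<subseteq> {L..M}"
    and "int (card {i. ?f i \<noteq> 0}) + 2 * (M - L) - \<bar>k\<bar>
      \<le> int (word_length lamplighter lamplighter_gens (?f, k))"
    by (rule word_length_support_interval)
  then show ?thesis
    using assms unfolding supp d_elem_gen_t_pow by auto
qed

lemma conj_length:
  assumes w: "(h, p) \<in> word_sphere lamplighter lamplighter_gens r"
    and k: "0 < k" and m: "int r + k < m"
  defines "N \<equiv> int (word_length lamplighter lamplighter_gens
    (inv\<^bsub>lamplighter\<^esub> (h, p) \<otimes>\<^bsub>lamplighter\<^esub>
      (d_elem m \<otimes>\<^bsub>lamplighter\<^esub> gen_t [^]\<^bsub>lamplighter\<^esub> k) \<otimes>\<^bsub>lamplighter\<^esub> (h, p)))"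
  shows "N \<le> 6 * m + 1 - k" and "h \<noteq> (\<lambda>_. 0) \<Longrightarrow> N < 6 * m + 1 - k"
proof -
  have hp: "(h, p) \<in> carrier lamplighter"
    and len: "word_length lamplighter lamplighter_gens (h, p) = r"
    using w by (auto simp: word_sphere_def)
  from hp have h01: "\<And>i. h i = 0 \<or> h i = 1" and fin: "finite {i. h i \<noteq> 0}"
    by (auto simp: carrier_lamplighter)
  obtain L M where "L \<le> 0" "0 \<le> M" "L \<le> - p" "- p \<le> M" and LM: "{i. h i \<noteq> 0} \<subseteq> {L..M}"
    and "int (card {i. h i \<noteq> 0}) + 2 * (M - L) - \<bar>p\<bar> \<le> int r"
    using word_length_support_interval[OF hp] unfolding len by metis
  \<comment> \<open>The interval contains 0 and \<open>- p\<close>, so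
    \<open>M - L \<ge> \<bar>p\<bar>\<close>, and the length bound leaves
    \<open>M - L \<le> int r\<close>.\<close>
  then have p: "\<bar>p\<bar> \<le> int r" and "- int r \<le> L" "M \<le> int r" by auto
  then have hr: "\<bar>i\<bar> \<le> int r" if "h i \<noteq> 0" for i
    using LM that by fastforce
  \<comment> \<open>The three summands come from the inverse of w = \<open>(h, p)\<close>, from d_m
    t^k and from w. The inverse moves the cursor to \<open>p\<close>, which recentres the
    configuration there.\<close>
  define F where
    "F i = (h (i - p) + (if \<bar>i - p\<bar> \<le> m then 1 else 0) + h (i - p + k)) mod 2" for i
  have conj: "inv\<^bsub>lamplighter\<^esub> (h, p) \<otimes>\<^bsub>lamplighter\<^esub>
      (d_elem m \<otimes>\<^bsub>lamplighter\<^esub> gen_t [^]\<^bsub>lamplighter\<^esub> k) \<otimes>\<^bsub>lamplighter\<^esub> (h, p) = (F, k)"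
    by (auto simp: d_elem_gen_t_pow inv_lamplighter[OF hp] mult_lamplighter fun_eq_iff F_def
        mod_add_left_eq mod_add_right_eq algebra_simps)
  have supp: "{i. F i \<noteq> 0} \<subseteq> {p - m..p + m}"
  proof
    fix i assume "i \<in> {i. F i \<noteq> 0}"
    then have "h (i - p) \<noteq> 0 \<or> \<bar>i - p\<bar> \<le> m \<or> h (i - p + k) \<noteq> 0"
      by (auto simp: F_def)
    then have "\<bar>i - p\<bar> \<le> m"
      using hr[of "i - p"] hr[of "i - p + k"] k m by auto
    then show "i \<in> {p - m..p + m}" by auto
  qed
  have "F i = 0 \<or> F i = 1" for i
    unfolding F_def by auto
  \<comment> \<open>The interval \<open>{p - m..p + m}\<close> contains 0, and
    \<open>p - m \<le> - k\<close> holds because \<open>m\<close> exceeds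
    \<open>int r + k\<close>.\<close>
  then have N: "N \<le> int (card {i. F i \<noteq> 0}) + 4 * m - k"
    using word_length_le_interval[OF _ supp, of k] p k m unfolding N_def conj by auto
  have card: "int (card {p - m..p + m}) = 2 * m + 1"
    using k m by simp
  have "card {i. F i \<noteq> 0} \<le> card {p - m..p + m}"
    using supp by (intro card_mono) auto
  with N card show "N \<le> 6 * m + 1 - k" by linarith
  assume "h \<noteq> (\<lambda>_. 0)"
  then have ne: "{i. h i \<noteq> 0} \<noteq> {}" by auto
  \<comment> \<open>By maximality and \<open>k > 0\<close> the second copy of \<open>h\<close>
    vanishes at the point belonging to \<open>j\<close>, so the first copy alone switches off a lamp
    of the block.\<close>
  define j where "j = Max {i. h i \<noteq> 0}"
  have "h j \<noteq> 0"
    using Max_in[OF fin ne] by (simp add: j_def)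
  moreover have "h (j + k) = 0"
    using Max_ge[OF fin, of "j + k"] k by (auto simp: j_def)
  moreover have "\<bar>j\<bar> \<le> m"
    using hr[of j] \<open>h j \<noteq> 0\<close> k m by linarith
  ultimately have "F (j + p) = 0"
    using h01[of j] by (simp add: F_def)
  moreover have "j + p \<in> {p - m..p + m}"
    using \<open>\<bar>j\<bar> \<le> m\<close> by auto
  ultimately have "{i. F i \<noteq> 0} \<subset> {p - m..p + m}"
    using supp by blast
  then have "card {i. F i \<noteq> 0} < card {p - m..p + m}"
    by (intro psubset_card_mono) auto
  with N card show "N < 6 * m + 1 - k" by linarith
qed

section \<open>Strictness and averaging over the sphere\<close>

text \<open>This is a t^q, which supplies an element with a lit lamp in every sphere of positive
  radius. The interval \<open>{- int q..0}\<close> gives the upper bound; the lower bound counts one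
  lamp and at least \<open>q\<close> moves.\<close>

lemma gen_a_shift_in_sphere:
  "((\<lambda>i. if i = 0 then 1 else 0), int q) \<in> word_sphere lamplighter lamplighter_gens (Suc q)"
proof -
  let ?f = "\<lambda>i::int. if i = 0 then 1 else 0 :: int"
  have supp: "{i. ?f i \<noteq> 0} = {0}" by auto
  have f01: "?f i = 0 \<or> ?f i = 1" for i by simp
  have mem: "(?f, int q) \<in> carrier lamplighter"
    by (simp add: carrier_lamplighter image_subset_iff)
  have "int (word_length lamplighter lamplighter_gens (?f, int q)) \<le> int (Suc q)"
    using word_length_le_interval[of ?f "- int q" 0 "int q", OF f01] unfolding supp by simp
  moreover obtain L M where "L \<le> 0" "0 \<le> M" "L \<le> - int q" "- int q \<le> M"
    and "int (card {i. ?f i \<noteq> 0}) + 2 * (M - L) - \<bar>int q\<bar>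
      \<le> int (word_length lamplighter lamplighter_gens (?f, int q))"
    using mem by (rule word_length_support_interval)
  ultimately show ?thesis
    using mem by (simp add: word_sphere_def supp)
qed

theorem theorem2p7:
  fixes r :: nat and k m :: int
  assumes "r \<ge> 1" and "k > 0" and "m > int r + k"
  shows "spherical_curvature lamplighter lamplighter_gens r
           (d_elem m \<otimes>\<^bsub>lamplighter\<^esub> gen_t [^]\<^bsub>lamplighter\<^esub> k) > 0"
proof -
  define g where "g = d_elem m \<otimes>\<^bsub>lamplighter\<^esub> gen_t [^]\<^bsub>lamplighter\<^esub> k"
  define len where "len = word_length lamplighter lamplighter_gens"
  define S where "S = word_sphere lamplighter lamplighter_gens r"
  define c where "c w = inv\<^bsub>lamplighter\<^esub> w \<otimes>\<^bsub>lamplighter\<^esub> g \<otimes>\<^bsub>lamplighter\<^esub> w" for w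
  \<comment> \<open>The lower bound for \<open>g\<close> equals the upper bound for its conjugates
    in \<open>conj_length\<close>, so the exact length of \<open>g\<close> need not be
    computed.\<close>
  have g: "6 * m + 1 - k \<le> int (len g)"
    unfolding g_def len_def by (rule d_elem_gen_t_pow_length) (use assms in auto)
  have le: "len (c w) \<le> len g" if "w \<in> S" for w
    using conj_length(1)[of "fst w" "snd w" r k m] that assms g
    by (simp add: S_def c_def g_def len_def)
  have lt: "len (c w) < len g" if "w \<in> S" "fst w \<noteq> (\<lambda>_. 0)" for w
    using conj_length(2)[of "fst w" "snd w" r k m] that assms g
    by (simp add: S_def c_def g_def len_def)
  \<comment> \<open>\<open>r \<ge> 1\<close> makes \<open>r - 1\<close> a true subtraction, so that
    \<open>v\<close> has length \<open>r\<close>.\<close>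
  define v where "v = ((\<lambda>i::int. if i = 0 then 1 else 0 :: int), int (r - 1))"
  have v: "v \<in> S"
    using gen_a_shift_in_sphere[of "r - 1"] assms by (simp add: v_def S_def)
  have "fst v \<noteq> (\<lambda>_. 0)"
    by (auto simp: v_def fun_eq_iff intro: exI[of _ 0])
  with v have "len (c v) < len g" by (rule lt)
  have fin: "finite S"
    unfolding S_def by (rule finite_lamplighter_sphere)
  \<comment> \<open>No conjugate is longer than \<open>g\<close> and the one by \<open>v\<close> is
    shorter, so the average drops strictly below \<open>len g\<close>.\<close>
  have "(\<Sum>w\<in>S. real (len (c w))) < (\<Sum>w\<in>S. real (len g))"
    using fin le v \<open>len (c v) < len g\<close> by (intro sum_strict_mono_ex1) auto
  then have "(\<Sum>w\<in>S. real (len (c w))) < real (card S) * real (len g)"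
    by simp
  moreover have "card S > 0"
    using fin v by (auto simp: card_gt_0_iff)
  moreover have "len g > 0"
    using \<open>len (c v) < len g\<close> by simp
  ultimately have "(real (len g) - 1 / real (card S) * (\<Sum>w\<in>S. real (len (c w)))) / real (len g) > 0"
    by (simp add: field_simps)
  then show ?thesis
    by (simp add: spherical_curvature_def g_def len_def S_def c_def)
qed

end
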